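(* There exists an absolute constant $K > 0$ such that for every integer $n \ge 1$ and every Eulerian binary matroid $M \subseteq \mathbb{F}_2^n \setminus \{0\}$, $$c(M) \le K \cdot \frac{2^{\operatorname{rank}(M)}}{\operatorname{rank}(M) + 1}.$$ That is, $c(M) = O\left(2^{\operatorname{rank}(M)} / (\operatorname{rank}(M)+1)\right)$.
   Context: A (simple) binary matroid is a subset $M \subseteq \mathbb{F}_2^n \setminus \{0\}$ for some $n \ge 1$. Its rank, $\operatorname{rank}(M)$, is the size of a largest subset of $M$ that is linearly independent over $\mathbb{F}_2$. $M$ is Eulerian if $\sum_{x \in M} x = 0$ in $\mathbb{F}_2^n$. A subset $N \subseteq M$ is a circuit if it is a minimal (with respect to inclusion) non-empty Eulerian subset of $M$. A circuit decomposition of $M$ is a collection of pairwise disjoint circuits of $M$ whose union is $M$; one exists if and only if $M$ is Eulerian. For Eulerian $M$, $c(M)$ denotes the minimum number of circuits in a circuit decomposition of $M$. *)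

theory Defs
  imports Complex_Main "HOL-Library.Z2" "HOL-Library.Function_Algebras"
begin

text \<open>
  The bound to be stated is uniform in the dimension, so the dimension \<open>n\<close> has to be a
  number rather than a type: $\mathbb{F}_2^n$ is the set of sequences of bits that vanish at all
  indices \<open>i \<ge> n\<close>. Addition and \<open>0\<close> are the pointwise operations on
  functions.
\<close>

definition F2_space :: "nat \<Rightarrow> (nat \<Rightarrow> bit) set" where
  "F2_space n = {x. \<forall>i\<ge>n. x i = 0}"

definition F2_scale :: "bit \<Rightarrow> (nat \<Rightarrow> bit) \<Rightarrow> (nat \<Rightarrow> bit)" where
  "F2_scale a x = (\<lambda>i. a * x i)"

global_interpretation F2: vector_space F2_scale
  by unfold_locales
    (simp_all only: F2_scale_def plus_fun_def distrib_left distrib_right mult.assoc mult_1)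

definition binary_matroid :: "nat \<Rightarrow> (nat \<Rightarrow> bit) set \<Rightarrow> bool" where
  "binary_matroid n M \<longleftrightarrow> M \<subseteq> F2_space n - {0}"

definition matroid_rank :: "(nat \<Rightarrow> bit) set \<Rightarrow> nat" where
  "matroid_rank M = Max {card S |S. S \<subseteq> M \<and> F2.independent S}"

text \<open>
  As \<open>F2_space n\<close> is finite, so is every binary matroid. The following notions are
  meant for finite sets only (a sum over an infinite set is \<open>0\<close> by convention).
\<close>

definition eulerian :: "(nat \<Rightarrow> bit) set \<Rightarrow> bool" where
  "eulerian M \<longleftrightarrow> (\<Sum>x\<in>M. x) = 0"

definition circuit :: "(nat \<Rightarrow> bit) set \<Rightarrow> (nat \<Rightarrow> bit) set \<Rightarrow> bool" where
  "circuit M N \<longleftrightarrow> N \<subseteq> M \<and> N \<noteq> {} \<and> eulerian N \<and>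
     (\<forall>N'. N' \<subseteq> N \<longrightarrow> N' \<noteq> {} \<longrightarrow> eulerian N' \<longrightarrow> N' = N)"

definition circuit_decomposition ::
    "(nat \<Rightarrow> bit) set \<Rightarrow> (nat \<Rightarrow> bit) set set \<Rightarrow> bool" where
  "circuit_decomposition M \<C> \<longleftrightarrow>
     (\<forall>N\<in>\<C>. circuit M N) \<and> pairwise disjnt \<C> \<and> \<Union>\<C> = M"

text \<open>The least number below exists exactly when \<open>M\<close> is Eulerian; otherwise it is unspecified.\<close>

definition circuit_number :: "(nat \<Rightarrow> bit) set \<Rightarrow> nat" where
  "circuit_number M = (LEAST k. \<exists>\<C>. circuit_decomposition M \<C> \<and> card \<C> = k)"

end

theory Submission
  imports Defs "HOL-Analysis.Convex"
begin

text \<open>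
  Write \<open>r\<close> for the rank of \<open>M\<close>, so that \<open>M\<close> lies in its span \<open>V\<close>, a space of \<open>2 ^ r\<close> vectors.
  The bound follows from greedy removal of long circuits, because a subset \<open>A\<close> of \<open>V\<close> contains a
  circuit of length about \<open>r / 2\<close> as soon as it has more than about \<open>2 ^ (3 * r / 4)\<close> elements,
  which is far below the density \<open>1 / r\<close> that could be afforded.

  Such a circuit is found by counting (\<open>long_circuit_exists\<close>). By the Cauchy--Schwarz inequality
  at least \<open>card A ^ (2 * m) / 2 ^ r\<close> pairs \<open>(xs, ys)\<close> of lists of length \<open>m\<close> over \<open>A\<close> satisfy
  \<open>sum_list xs = sum_list ys\<close>, and in such a pair the last entry of \<open>ys\<close> is the sum of the other
  \<open>2 * m - 1\<close> entries. On the other hand few lists of length \<open>2 * m - 1\<close> are linearly dependent,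
  since each entry has to avoid only the span of the other ones, which is small compared to
  \<open>A\<close> (\<open>card_dependent_lists\<close>). So some pair has \<open>2 * m - 1\<close> independent entries whose sum also
  lies in \<open>A\<close>, and independent vectors together with their sum form a circuit.

  With \<open>m\<close> slightly above \<open>r / 4\<close>, the circuits removed are disjoint and have more than
  \<open>(r + 1) / 2\<close> elements, so there are at most \<open>2 * 2 ^ r / (r + 1)\<close> of them. When no long circuit
  can be guaranteed any more, only \<open>O(2 ^ (3 * r / 4))\<close> elements are left, and even if each further
  circuit is charged for a single element the total stays \<open>O(2 ^ r / (r + 1))\<close>
  (\<open>greedy_circuit_decomposition\<close>).
\<close>

section \<open>Circuits from independent vectors\<close>

lemma F2_vector_add_self: "x + x = (0 :: nat \<Rightarrow> bit)"
  by (simp add: fun_eq_iff)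

lemma F2_vector_add_eq_0_iff: "x + y = 0 \<longleftrightarrow> x = (y :: nat \<Rightarrow> bit)"
  by (metis F2_vector_add_self add_left_imp_eq)

lemma eulerian_Diff:
  assumes "finite M" "N \<subseteq> M" "eulerian M" "eulerian N"
  shows "eulerian (M - N)"
  using assms by (simp add: eulerian_def sum_diff)

lemma eulerian_subset_independent:
  assumes "F2.independent S" "finite S" "N \<subseteq> S" "eulerian N"
  shows "N = {}"
proof (rule ccontr)
  assume "N \<noteq> {}"
  then obtain v where v: "v \<in> N" by blast
  have "(\<Sum>v\<in>N. F2_scale 1 v) = 0"
    using assms(4) by (simp add: eulerian_def)
  moreover have "finite N"
    using assms(2,3) finite_subset by blast
  ultimately have "(1::bit) = 0"
    using F2.independentD[OF assms(1) _ assms(3), of "\<lambda>_. 1"] v by blast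
  then show False by simp
qed

text \<open>
  The only nontrivial linear relation among the elements of \<open>insert (\<Sum>S) S\<close> involves all of them.
  For \<open>card S = 1\<close> the sum would be the element of \<open>S\<close> itself.
\<close>

lemma circuit_insert_sum:
  assumes indep: "F2.independent S" and card: "card S \<ge> 2"
  shows "circuit (insert (\<Sum>S) S) (insert (\<Sum>S) S)" and "\<Sum>S \<notin> S"
proof -
  have fin: "finite S"
    using card by (metis card.infinite not_numeral_le_zero)
  show notin: "\<Sum>S \<notin> S"
  proof
    assume y: "\<Sum>S \<in> S"
    then have "eulerian (S - {\<Sum>S})"
      using fin by (simp add: eulerian_def sum_diff1)
    then have "S - {\<Sum>S} = {}"
      by (intro eulerian_subset_independent[OF indep fin]) auto
    then have "S \<subseteq> {\<Sum>S}" by blast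
    then have "card S \<le> 1"
      using card_mono[of "{\<Sum>S}" S] by simp
    with card show False by simp
  qed
  have eul: "eulerian (insert (\<Sum>S) S)"
    using fin notin by (simp add: eulerian_def F2_vector_add_self)
  have "N = insert (\<Sum>S) S"
    if N: "N \<subseteq> insert (\<Sum>S) S" "N \<noteq> {}" "eulerian N" for N
  proof (cases "\<Sum>S \<in> N")
    case False
    with N eulerian_subset_independent[OF indep fin, of N] show ?thesis by blast
  next
    case True
    then have "insert (\<Sum>S) S - N \<subseteq> S" by blast
    moreover have "eulerian (insert (\<Sum>S) S - N)"
      using eulerian_Diff[OF _ N(1) eul N(3)] fin by blast
    ultimately have "insert (\<Sum>S) S - N = {}"
      using eulerian_subset_independent[OF indep fin] by blast
    with N(1) show ?thesis by blast
  qed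
  with eul show "circuit (insert (\<Sum>S) S) (insert (\<Sum>S) S)"
    by (auto simp: circuit_def)
qed

lemma circuit_mono: "circuit N N \<Longrightarrow> N \<subseteq> M \<Longrightarrow> circuit M N"
  by (auto simp: circuit_def)

lemma eulerian_imp_circuit:
  assumes "finite M" "eulerian M" "M \<noteq> {}"
  shows "\<exists>N. circuit M N"
  using assms
proof (induction M rule: finite_psubset_induct)
  case (psubset M)
  show ?case
  proof (cases "circuit M M")
    case False
    then obtain N where "N \<subset> M" "N \<noteq> {}" "eulerian N"
      using psubset.prems unfolding circuit_def by blast
    with psubset.IH obtain N' where "circuit N N'" by blast
    then have "circuit M N'"
      using \<open>N \<subset> M\<close> by (auto simp: circuit_def)
    then show ?thesis by blast
  qed blast
qed

section \<open>Counting linearly dependent lists\<close>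

definition independent_list :: "(nat \<Rightarrow> bit) list \<Rightarrow> bool" where
  "independent_list xs \<longleftrightarrow> distinct xs \<and> F2.independent (set xs)"

lemma independent_list_Cons:
  "independent_list xs \<Longrightarrow> x \<notin> F2.span (set xs) \<Longrightarrow> independent_list (x # xs)"
  by (auto simp: independent_list_def F2.independent_insert intro: F2.span_base)

lemma span_insert_F2: "F2.span (insert a S) = F2.span S \<union> (+) a ` F2.span S"
proof (intro equalityI subsetI)
  fix x assume "x \<in> F2.span (insert a S)"
  then obtain k where k: "x - F2_scale k a \<in> F2.span S"
    by (auto simp: F2.span_breakdown_eq)
  show "x \<in> F2.span S \<union> (+) a ` F2.span S"
  proof (cases k)
    case zero
    with k show ?thesis by simp
  next
    case one
    with k have "x - a \<in> F2.span S" by simp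
    moreover have "x = a + (x - a)" by simp
    ultimately show ?thesis by blast
  qed
next
  fix x assume "x \<in> F2.span S \<union> (+) a ` F2.span S"
  then show "x \<in> F2.span (insert a S)"
    by (auto intro!: F2.span_add intro: F2.span_base F2.span_mono[THEN subsetD, of S])
qed

lemma finite_card_span_F2:
  assumes "finite S"
  shows "finite (F2.span S) \<and> card (F2.span S) \<le> 2 ^ card S"
  using assms
proof (induction S rule: finite_induct)
  case (insert a S)
  have "card (F2.span (insert a S)) \<le> card (F2.span S) + card ((+) a ` F2.span S)"
    by (simp add: span_insert_F2 card_Un_le)
  also have "\<dots> \<le> 2 * card (F2.span S)"
    using insert.IH card_image_le[of "F2.span S" "(+) a"] by simp
  finally show ?case
    using insert by (simp add: span_insert_F2)
qed simp

text \<open>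
  A new entry makes an independent list of length \<open>k\<close> dependent only if it is one of the at most
  \<open>2 ^ k\<close> elements of its span, so a proportion of at most
  \<open>(2 ^ 0 + \<dots> + 2 ^ (k - 1)) / card A = (2 ^ k - 1) / card A\<close> of all lists is dependent. The strict
  gain of \<open>1\<close> carries the induction.
\<close>

lemma card_dependent_lists:
  assumes A: "finite A"
  shows "card {xs. set xs \<subseteq> A \<and> length xs = k \<and> \<not> independent_list xs} * card A + card A ^ k
    \<le> 2 ^ k * card A ^ k"
proof (induction k)
  case 0
  have "{xs. set xs \<subseteq> A \<and> length xs = 0 \<and> \<not> independent_list xs} = {}"
    using F2.independent_empty by (auto simp: independent_list_def)
  then show ?case by simp
next
  case (Suc k)
  define D where "D k = {xs. set xs \<subseteq> A \<and> length xs = k \<and> \<not> independent_list xs}" for k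
  define L where "L = {xs. set xs \<subseteq> A \<and> length xs = k}"
  have finL: "finite L" and cardL: "card L = card A ^ k"
    unfolding L_def using A by (simp_all add: finite_lists_length_eq card_lists_length_eq)
  have finD: "finite (D k)"
    by (rule finite_subset[OF _ finL]) (auto simp: D_def L_def)
  have finS: "finite (SIGMA xs:L. F2.span (set xs))"
    using finL finite_card_span_F2 by auto
  \<comment> \<open>A dependent list has a dependent tail, or its head lies in the span of its tail.\<close>
  have "D (Suc k) \<subseteq> (\<lambda>(x, xs). x # xs) ` (A \<times> D k) \<union>
      (\<lambda>(xs, x). x # xs) ` (SIGMA xs:L. F2.span (set xs))"
  proof
    fix ys assume ys: "ys \<in> D (Suc k)"
    then obtain x xs where [simp]: "ys = x # xs"
      by (cases ys) (auto simp: D_def)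
    show "ys \<in> (\<lambda>(x, xs). x # xs) ` (A \<times> D k) \<union>
        (\<lambda>(xs, x). x # xs) ` (SIGMA xs:L. F2.span (set xs))"
      using ys independent_list_Cons[of xs x] by (force simp: D_def L_def)
  qed
  then have "card (D (Suc k)) \<le> card ((\<lambda>(x, xs). x # xs) ` (A \<times> D k) \<union>
      (\<lambda>(xs, x). x # xs) ` (SIGMA xs:L. F2.span (set xs)))"
    using A finD finS by (intro card_mono) auto
  also have "\<dots> \<le> card ((\<lambda>(x, xs). x # xs) ` (A \<times> D k)) +
      card ((\<lambda>(xs, x). x # xs) ` (SIGMA xs:L. F2.span (set xs)))"
    by (rule card_Un_le)
  also have "\<dots> \<le> card (A \<times> D k) + card (SIGMA xs:L. F2.span (set xs))"
    using A finD finS by (intro add_mono card_image_le) auto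
  also have "card (SIGMA xs:L. F2.span (set xs)) = (\<Sum>xs\<in>L. card (F2.span (set xs)))"
    using finL finite_card_span_F2 by (intro card_SigmaI) auto
  also have "\<dots> \<le> (\<Sum>xs\<in>L. 2 ^ k)"
  proof (rule sum_mono)
    fix xs assume "xs \<in> L"
    then have "card (set xs) \<le> k"
      using card_length[of xs] by (simp add: L_def)
    then have "(2::nat) ^ card (set xs) \<le> 2 ^ k" by simp
    with finite_card_span_F2[of "set xs"] show "card (F2.span (set xs)) \<le> 2 ^ k"
      by (meson List.finite_set le_trans)
  qed
  finally have "card (D (Suc k)) \<le> card A * card (D k) + card A ^ k * 2 ^ k"
    by (simp add: cardL card_cartesian_product)
  then have "card (D (Suc k)) * card A + card A ^ Suc k
      \<le> (card A * card (D k) + card A ^ k * 2 ^ k) * card A + card A ^ Suc k"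
    by simp
  also have "\<dots> = card A * (card (D k) * card A + card A ^ k) + 2 ^ k * card A ^ Suc k"
    by (simp add: algebra_simps)
  also have "\<dots> \<le> card A * (2 ^ k * card A ^ k) + 2 ^ k * card A ^ Suc k"
    using Suc.IH unfolding D_def by (intro add_mono mult_left_mono) auto
  also have "\<dots> = 2 ^ Suc k * card A ^ Suc k" by simp
  finally show ?case unfolding D_def .
qed

section \<open>Long circuits in large sets\<close>

text \<open>
  The Cauchy--Schwarz inequality for the sizes of the fibres of \<open>f\<close>: these add up to \<open>card W\<close>, and
  their squares add up to the number of colliding pairs.
\<close>

lemma card_collisions_ge:
  assumes V: "finite V" and W: "finite W" and f: "f ` W \<subseteq> V"
  shows "(card W)\<^sup>2 \<le> card V * card {(x, y). x \<in> W \<and> y \<in> W \<and> f x = f y}"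
proof -
  have "{(x, y). x \<in> W \<and> y \<in> W \<and> f x = f y}
      = (\<Union>v\<in>V. {x \<in> W. f x = v} \<times> {x \<in> W. f x = v})"
    using f by auto
  also have "card \<dots> = (\<Sum>v\<in>V. card ({x \<in> W. f x = v} \<times> {x \<in> W. f x = v}))"
    using V W by (intro card_UN_disjoint) auto
  finally have coll: "card {(x, y). x \<in> W \<and> y \<in> W \<and> f x = f y}
      = (\<Sum>v\<in>V. (card {x \<in> W. f x = v})\<^sup>2)"
    by (simp add: card_cartesian_product power2_eq_square)
  have "W = (\<Union>v\<in>V. {x \<in> W. f x = v})"
    using f by auto
  moreover have "card (\<Union>v\<in>V. {x \<in> W. f x = v}) = (\<Sum>v\<in>V. card {x \<in> W. f x = v})"
    using V W by (intro card_UN_disjoint) auto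
  ultimately have "card W = (\<Sum>v\<in>V. card {x \<in> W. f x = v})"
    by simp
  then have "real ((card W)\<^sup>2) = (\<Sum>v\<in>V. real (card {x \<in> W. f x = v}))\<^sup>2"
    by simp
  also have "\<dots> \<le> (\<Sum>v\<in>V. (real (card {x \<in> W. f x = v}))\<^sup>2) * card V"
    by (rule sum_squared_le_sum_of_squares)
  also have "\<dots> = real (card V * card {(x, y). x \<in> W \<and> y \<in> W \<and> f x = f y})"
    unfolding coll by simp
  finally show ?thesis by (simp only: of_nat_le_iff)
qed

lemma sum_list_mem_subspace:
  assumes "F2.subspace V" "set xs \<subseteq> V"
  shows "sum_list xs \<in> V"
  using assms by (induction xs) (auto intro: F2.subspace_0 F2.subspace_add)

text \<open>
  In a pair of lists with equal sums the last entry is determined by the other ones, as their sum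
  because \<open>-x = x\<close>. The pairs therefore embed into the lists of length \<open>2 * m - 1\<close>, and the
  hypothesis on \<open>card A\<close> says that they outnumber the dependent ones among these.
\<close>

lemma long_circuit_exists:
  assumes V: "F2.subspace V" "finite V" and A: "A \<subseteq> V" and m: "m \<ge> 2"
    and large: "card V * 2 ^ (2 * m - 1) < (card A)\<^sup>2"
  shows "\<exists>N. circuit A N \<and> card N = 2 * m"
proof -
  define k where "k = 2 * m - 1"
  \<comment> \<open>\<open>D\<close> collects the dependent lists, \<open>P\<close> the pairs with equal sums, and \<open>h\<close> embeds \<open>P\<close> into the
    lists of length \<open>k\<close>.\<close>
  define W where "W = {xs. set xs \<subseteq> A \<and> length xs = m}"
  define P where "P = {(xs, ys). xs \<in> W \<and> ys \<in> W \<and> sum_list xs = sum_list ys}"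
  define D where "D = {zs. set zs \<subseteq> A \<and> length zs = k \<and> \<not> independent_list zs}"
  define h where "h = (\<lambda>(xs, ys :: (nat \<Rightarrow> bit) list). xs @ butlast ys)"
  have finA: "finite A"
    using V(2) A finite_subset by blast
  have card_A_pos: "card A > 0"
    using large by (cases "card A = 0") auto
  have finW: "finite W" and cardW: "card W = card A ^ m"
    unfolding W_def using finA by (simp_all add: finite_lists_length_eq card_lists_length_eq)
  have finD: "finite D"
    by (rule finite_subset[OF _ finite_lists_length_eq[OF finA, of k]]) (auto simp: D_def)
  have cardP: "(card A ^ m)\<^sup>2 \<le> card V * card P"
    unfolding P_def cardW[symmetric]
    using V A by (intro card_collisions_ge finW) (auto simp: W_def intro!: sum_list_mem_subspace)
  have last_eq: "last ys = sum_list (h (xs, ys))" and set_h: "set (h (xs, ys)) \<subseteq> A"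
    and length_h: "length (h (xs, ys)) = k" and last_mem: "last ys \<in> A"
    and take_h: "take m (h (xs, ys)) = xs" and drop_h: "drop m (h (xs, ys)) = butlast ys"
    and ys_ne: "ys \<noteq> []"
    if "(xs, ys) \<in> P" for xs ys
  proof -
    from that have *: "set xs \<subseteq> A" "length xs = m" "set ys \<subseteq> A" "length ys = m"
      "sum_list xs = sum_list ys"
      by (auto simp: P_def W_def)
    with m show ne: "ys \<noteq> []" by auto
    then have ys: "ys = butlast ys @ [last ys]" by simp
    have "sum_list xs = sum_list (butlast ys) + last ys"
      using *(5) ys by (metis add_0_right sum_list.Cons sum_list.Nil sum_list.append)
    moreover have "sum_list (h (xs, ys)) = sum_list xs + sum_list (butlast ys)"
      by (simp add: h_def)
    ultimately show "last ys = sum_list (h (xs, ys))"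
      by (metis F2_vector_add_self add.assoc add.commute add_0)
    show "last ys \<in> A"
      using * ne by auto
    show "set (h (xs, ys)) \<subseteq> A"
      using * by (auto simp: h_def dest: in_set_butlastD)
    show "length (h (xs, ys)) = k"
      using * m by (simp add: h_def k_def)
    show "take m (h (xs, ys)) = xs" "drop m (h (xs, ys)) = butlast ys"
      using * by (simp_all add: h_def)
  qed
  have inj: "inj_on h P"
  proof (rule inj_onI, clarify)
    fix xs ys xs' ys' assume P: "(xs, ys) \<in> P" "(xs', ys') \<in> P" and eq: "h (xs, ys) = h (xs', ys')"
    have "xs = xs'" "butlast ys = butlast ys'" "last ys = last ys'"
      using take_h[OF P(1)] take_h[OF P(2)] drop_h[OF P(1)] drop_h[OF P(2)]
        last_eq[OF P(1)] last_eq[OF P(2)] eq by simp_all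
    then show "xs = xs' \<and> ys = ys'"
      using ys_ne[OF P(1)] ys_ne[OF P(2)] by (metis append_butlast_last_id)
  qed
  have "\<not> h ` P \<subseteq> D"
  proof
    assume "h ` P \<subseteq> D"
    then have "card P \<le> card D"
      using card_inj_on_le[OF inj _ finD] by blast
    then have "card V * card P \<le> card V * card D"
      by (rule mult_le_mono2)
    with cardP have "card A ^ (2 * m) \<le> card V * card D"
      unfolding power_even_eq by (rule le_trans)
    then have "card A ^ (2 * m) * card A \<le> card V * (card D * card A)"
      unfolding mult.assoc[symmetric] by (rule mult_le_mono1)
    also have "\<dots> \<le> card V * (2 ^ k * card A ^ k)"
      using card_dependent_lists[OF finA, of k] unfolding D_def
      by (intro mult_left_mono) auto
    also have "\<dots> = (card V * 2 ^ k) * card A ^ k" by simp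
    also have "\<dots> < (card A)\<^sup>2 * card A ^ k"
      using large card_A_pos by (intro mult_strict_right_mono) (simp_all add: k_def)
    also have "\<dots> = card A ^ (2 * m) * card A"
    proof -
      have "2 + k = Suc (2 * m)" using m by (simp add: k_def)
      then show ?thesis by (metis power_add power_Suc2)
    qed
    finally show False by simp
  qed
  then obtain xs ys where P: "(xs, ys) \<in> P" and "h (xs, ys) \<notin> D"
    by (metis image_subsetI surj_pair)
  define S where "S = set (h (xs, ys))"
  have ind: "independent_list (h (xs, ys))"
    using \<open>h (xs, ys) \<notin> D\<close> set_h[OF P] length_h[OF P] by (simp add: D_def)
  then have S: "F2.independent S" and card_S: "card S = k"
    using length_h[OF P] by (auto simp: S_def independent_list_def distinct_card)
  have "\<Sum>S = last ys"
    using ind last_eq[OF P] by (simp add: S_def independent_list_def sum_list_distinct_conv_sum_set[of _ id, simplified])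
  then have sub: "insert (\<Sum>S) S \<subseteq> A"
    using last_mem[OF P] set_h[OF P] by (simp add: S_def)
  have "card S \<ge> 2" using card_S m by (simp add: k_def)
  from circuit_insert_sum[OF S this] have "circuit A (insert (\<Sum>S) S)" "\<Sum>S \<notin> S"
    using sub circuit_mono by blast+
  moreover have "card (insert (\<Sum>S) S) = 2 * m"
    using \<open>\<Sum>S \<notin> S\<close> card_S m by (simp add: S_def k_def)
  ultimately show ?thesis by blast
qed

section \<open>Greedy circuit decompositions\<close>

text \<open>
  A circuit that is removed while more than \<open>t\<close> elements are left has at least \<open>l\<close> elements, so
  there are at most \<open>card A / l\<close> of these. Below the threshold every circuit still uses up an
  element. The minimum keeps track of both phases in a single induction.
\<close>

lemma greedy_circuit_decomposition:
  assumes "finite A" "eulerian A"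
    and "\<And>B. B \<subseteq> A \<Longrightarrow> t < card B \<Longrightarrow> \<exists>N. circuit B N \<and> l \<le> card N"
  shows "\<exists>\<C>. circuit_decomposition A \<C> \<and> l * card \<C> \<le> card A + l * min t (card A)"
  using assms
proof (induction A rule: finite_psubset_induct)
  case (psubset A)
  show ?case
  proof (cases "A = {}")
    case True
    then have "circuit_decomposition A {}"
      by (simp add: circuit_decomposition_def)
    then show ?thesis by (intro exI[of _ "{}"]) simp
  next
    case False
    obtain N where N: "circuit A N" and long: "t < card A \<Longrightarrow> l \<le> card N"
      using psubset.prems(2)[of A] eulerian_imp_circuit[OF psubset.hyps psubset.prems(1) False]
      by (cases "t < card A") auto
    have sub: "N \<subseteq> A" and ne: "N \<noteq> {}" and eul: "eulerian N"
      using N by (auto simp: circuit_def)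
    have "A - N \<subset> A" using sub ne by blast
    moreover have "eulerian (A - N)"
      using eulerian_Diff[OF psubset.hyps sub psubset.prems(1) eul] .
    ultimately obtain \<C> where \<C>: "circuit_decomposition (A - N) \<C>"
      "l * card \<C> \<le> card (A - N) + l * min t (card (A - N))"
      using psubset.IH[of "A - N"] psubset.prems(2) by blast
    have "circuit_decomposition A (insert N \<C>)"
      unfolding circuit_decomposition_def
    proof (intro conjI ballI)
      fix N' assume "N' \<in> insert N \<C>"
      then show "circuit A N'"
        using N \<C>(1) by (auto simp: circuit_decomposition_def circuit_def)
    next
      show "pairwise disjnt (insert N \<C>)"
        using \<C>(1) by (auto simp: circuit_decomposition_def pairwise_insert disjnt_def)
      show "\<Union>(insert N \<C>) = A"
        using \<C>(1) sub by (auto simp: circuit_decomposition_def)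
    qed
    moreover have "l * card (insert N \<C>) \<le> card A + l * min t (card A)"
    proof -
      have finN: "finite N" using sub psubset.hyps finite_subset by blast
      have card_A: "card A = card (A - N) + card N"
        using card_Diff_subset[OF finN sub] card_mono[OF psubset.hyps sub] by simp
      have "card N > 0" using finN ne by (simp add: card_gt_0_iff)
      have "l * card (insert N \<C>) \<le> l * card \<C> + l"
        using card_insert_le_m1[of "Suc (card \<C>)" \<C> N] mult_le_mono2[of "card (insert N \<C>)" "Suc (card \<C>)" l]
        by simp
      also have "\<dots> \<le> card (A - N) + l * min t (card (A - N)) + l"
        using \<C>(2) by simp
      also have "\<dots> \<le> card A + l * min t (card A)"
      proof (cases "t < card A")
        case True
        with long have "l \<le> card N" by blast
        moreover have "l * min t (card (A - N)) \<le> l * min t (card A)"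
          using card_A by (intro mult_le_mono2) auto
        ultimately show ?thesis using card_A by linarith
      next
        case False
        then have "Suc (min t (card (A - N))) \<le> min t (card A)"
          using card_A \<open>card N > 0\<close> by auto
        then have "l * Suc (min t (card (A - N))) \<le> l * min t (card A)"
          by (rule mult_le_mono2)
        then show ?thesis using card_A by simp
      qed
      finally show ?thesis .
    qed
    ultimately show ?thesis by blast
  qed
qed

lemma circuit_number_le:
  "circuit_decomposition M \<C> \<Longrightarrow> circuit_number M \<le> card \<C>"
  unfolding circuit_number_def by (rule Least_le) blast

section \<open>The bound in terms of the rank\<close>

lemma finite_binary_matroid:
  assumes "binary_matroid n M"
  shows "finite M"
proof (rule finite_subset)
  show "M \<subseteq> {f. \<forall>i. (i \<in> {..<n} \<longrightarrow> f i \<in> {0, 1}) \<and> (i \<notin> {..<n} \<longrightarrow> f i = 0)}"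
    using assms by (auto simp: binary_matroid_def F2_space_def)
  show "finite {f :: nat \<Rightarrow> bit. \<forall>i. (i \<in> {..<n} \<longrightarrow> f i \<in> {0, 1}) \<and> (i \<notin> {..<n} \<longrightarrow> f i = 0)}"
    by (intro finite_set_of_finite_funs) auto
qed

lemma card_span_le_rank:
  assumes M: "finite M"
  shows "finite (F2.span M)" and "card (F2.span M) \<le> 2 ^ matroid_rank M"
proof -
  define R where "R = {card S |S. S \<subseteq> M \<and> F2.independent S}"
  have finR: "finite R"
    by (rule finite_subset[of _ "card ` Pow M"]) (use M in \<open>auto simp: R_def\<close>)
  moreover have "R \<noteq> {}"
    using F2.independent_empty unfolding R_def by blast
  ultimately have "Max R \<in> R" by (rule Max_in)
  then obtain B where B: "B \<subseteq> M" "F2.independent B" and card_B: "card B = matroid_rank M"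
    by (auto simp: R_def matroid_rank_def)
  have finB: "finite B" using B(1) M finite_subset by blast
  have "M \<subseteq> F2.span B"
  proof
    fix x assume "x \<in> M"
    show "x \<in> F2.span B"
    proof (rule ccontr)
      assume x: "x \<notin> F2.span B"
      then have "x \<notin> B" using F2.span_base by blast
      have "card (insert x B) \<in> R"
        using x B \<open>x \<in> M\<close> F2.independent_insertI unfolding R_def by blast
      then have "card (insert x B) \<le> card B"
        using Max_ge[OF finR] card_B by (simp add: R_def matroid_rank_def)
      with finB \<open>x \<notin> B\<close> show False by simp
    qed
  qed
  then have "F2.span M \<subseteq> F2.span B"
    by (rule F2.span_minimal) (rule F2.subspace_span)
  with finite_card_span_F2[OF finB] card_B
  show "finite (F2.span M)" "card (F2.span M) \<le> 2 ^ matroid_rank M"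
    using card_mono[of "F2.span B" "F2.span M"] finite_subset by auto
qed

text \<open>
  With \<open>q = r div 4\<close>, circuits of length \<open>2 * (q + 2)\<close> exist as long as
  \<open>(card A)\<^sup>2 > 2 ^ (r + 2 * q + 3)\<close>. This holds for \<open>card A > 12 * 2 ^ r / (r + 1)\<close>, because
  \<open>r + 1 \<le> 4 * (q + 1) \<le> 4 * 2 ^ q\<close> and \<open>4 * q \<le> r\<close>, with \<open>8 * 4\<^sup>2 \<le> 12\<^sup>2\<close> for the constants.
\<close>

lemma long_circuit_threshold:
  fixes r a :: nat
  assumes "12 * 2 ^ r < a * (r + 1)"
  shows "2 ^ r * 2 ^ (2 * (r div 4 + 2) - 1) < a\<^sup>2"
proof (rule ccontr)
  define q where "q = r div 4"
  assume small: "\<not> ?thesis"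
  have a: "a\<^sup>2 \<le> 2 ^ r * 2 ^ (2 * q + 3)"
  proof -
    have "2 * (r div 4 + 2) - 1 = 2 * q + 3" by (simp add: q_def)
    with small show ?thesis by (metis not_le)
  qed
  have "r + 1 \<le> 4 * (q + 1)" unfolding q_def by presburger
  also have "\<dots> \<le> 4 * 2 ^ q"
    using less_exp[of q] by (intro mult_le_mono2) linarith
  finally have r: "r + 1 \<le> 4 * 2 ^ q" .
  have "(a * (r + 1))\<^sup>2 \<le> 2 ^ r * 2 ^ (2 * q + 3) * (4 * 2 ^ q)\<^sup>2"
    unfolding power_mult_distrib[of a] using a r by (intro mult_le_mono power_mono) auto
  also have "\<dots> = 128 * 2 ^ (r + 4 * q)"
  proof -
    have "(2::nat) ^ (2 * q + 3) = 8 * (2 ^ q)\<^sup>2"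
      by (simp add: power_add power_even_eq)
    moreover have "(2::nat) ^ (r + 4 * q) = 2 ^ r * (2 ^ q) ^ 4"
      by (metis power_add power_mult mult.commute)
    ultimately show ?thesis
      by (simp only: power2_eq_square power4_eq_xxxx)
  qed
  also have "\<dots> \<le> 144 * 2 ^ (r + r)"
    by (intro mult_le_mono power_increasing) (auto simp: q_def)
  also have "\<dots> = (12 * 2 ^ r)\<^sup>2"
    by (simp add: power_add power2_eq_square)
  finally have "a * (r + 1) \<le> 12 * 2 ^ r"
    by (rule power2_le_imp_le) simp
  with assms show False by simp
qed

theorem theorem1p1:
  "\<exists>K::real. K > 0 \<and>
     (\<forall>(n::nat) (M :: (nat \<Rightarrow> bit) set).
        n \<ge> 1 \<longrightarrow> binary_matroid n M \<longrightarrow> eulerian M \<longrightarrow>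
        real (circuit_number M) \<le> K * (2 ^ matroid_rank M / (real (matroid_rank M) + 1)))"
proof (intro exI[of _ 14] conjI allI impI)
  fix n :: nat and M :: "(nat \<Rightarrow> bit) set"
  assume matroid: "binary_matroid n M" and eul: "eulerian M"
  define r where "r = matroid_rank M"
  define m where "m = r div 4 + 2"
  define t where "t = 12 * 2 ^ r div (r + 1)"
  have finM: "finite M" using matroid by (rule finite_binary_matroid)
  have fin_span: "finite (F2.span M)" and card_span: "card (F2.span M) \<le> 2 ^ r"
    using card_span_le_rank[OF finM] by (simp_all add: r_def)
  have "\<exists>N. circuit B N \<and> 2 * m \<le> card N" if B: "B \<subseteq> M" "t < card B" for B
  proof -
    have "12 * 2 ^ r < card B * (r + 1)"
      using B(2) unfolding t_def by (simp add: div_less_iff_less_mult)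
    then have "2 ^ r * 2 ^ (2 * m - 1) < (card B)\<^sup>2"
      unfolding m_def by (rule long_circuit_threshold)
    then have "card (F2.span M) * 2 ^ (2 * m - 1) < (card B)\<^sup>2"
      using card_span by (meson le_less_trans mult_le_mono1)
    moreover have "B \<subseteq> F2.span M"
      using B(1) F2.span_superset by blast
    ultimately have "\<exists>N. circuit B N \<and> card N = 2 * m"
      using fin_span by (intro long_circuit_exists[of "F2.span M"]) (auto simp: m_def)
    then show ?thesis by auto
  qed
  then obtain \<C> where \<C>: "circuit_decomposition M \<C>"
    and le: "2 * m * card \<C> \<le> card M + 2 * m * min t (card M)"
    using greedy_circuit_decomposition[OF finM eul, of t "2 * m"] by blast
  have "card M \<le> 2 ^ r"
    using card_mono[OF fin_span F2.span_superset] card_span by linarith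
  moreover have "2 * m * min t (card M) \<le> 2 * m * t"
    by (intro mult_le_mono2) simp
  ultimately have le': "2 * m * card \<C> \<le> 2 ^ r + 2 * m * t"
    using le by linarith
  have "r + 1 \<le> 2 * (2 * m)" unfolding m_def by presburger
  moreover have "t * (r + 1) \<le> 12 * 2 ^ r"
    unfolding t_def by (rule div_times_less_eq_dividend)
  ultimately have "2 * m * (card \<C> * (r + 1)) \<le> 2 * m * (14 * 2 ^ r)"
  proof -
    have "2 * m * (card \<C> * (r + 1)) \<le> (2 ^ r + 2 * m * t) * (r + 1)"
      using mult_le_mono1[OF le', of "r + 1"] by (simp only: mult.assoc)
    also have "\<dots> = 2 ^ r * (r + 1) + 2 * m * (t * (r + 1))"
      by (simp only: add_mult_distrib mult.assoc)
    also have "\<dots> \<le> 2 ^ r * (2 * (2 * m)) + 2 * m * (12 * 2 ^ r)"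
      using \<open>r + 1 \<le> 2 * (2 * m)\<close> \<open>t * (r + 1) \<le> 12 * 2 ^ r\<close>
      by (intro add_mono mult_le_mono2)
    also have "\<dots> = 2 * m * (14 * 2 ^ r)" by simp
    finally show ?thesis .
  qed
  moreover have "0 < 2 * m" by (simp add: m_def)
  ultimately have "card \<C> * (r + 1) \<le> 14 * 2 ^ r"
    by (simp only: nat_mult_le_cancel1)
  then have "circuit_number M * (r + 1) \<le> 14 * 2 ^ r"
    using circuit_number_le[OF \<C>] by (meson le_trans mult_le_mono1)
  then have "real (circuit_number M * (r + 1)) \<le> real (14 * 2 ^ r)"
    by (simp only: of_nat_le_iff)
  then show "real (circuit_number M)
      \<le> 14 * (2 ^ matroid_rank M / (real (matroid_rank M) + 1))"
    unfolding r_def[symmetric] by (simp add: field_simps)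
qed simp

end
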